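(* Let $\mathbb{K}\in\{\mathbb{R},\mathbb{C},\mathbb{H},\mathbb{O}\}$, $\ell=\dim_{\mathbb{R}}\mathbb{K}$, and let $a_1,\dots,a_\ell\in\mathbb{K}$ be a system of simple roots of a finite-type root system in the Euclidean space $\mathbb{K}$, with highest root $\theta$, normalized so that $\theta\bar\theta=1$. Let $\varepsilon_i=a_i/\sqrt{N(a_i)}$ for $i=1,\dots,\ell$. Define the $(2\times2)$ matrices $$M_{-1}=\begin{pmatrix}0&1\\1&0\end{pmatrix},\quad M_0=\begin{pmatrix}-\theta&1\\0&\bar\theta\end{pmatrix},\quad M_i=\begin{pmatrix}\varepsilon_i&0\\0&-\bar\varepsilon_i\end{pmatrix}\quad(i=1,\dots,\ell).$$ For a Hermitian matrix $X\in H_2(\mathbb{K})$ let $\bar X$ denote the matrix $X$ with each entry conjugated but not transposed. Then the simple reflections $$w_I(X)=X-\frac{2(X,\alpha_I)}{(\alpha_I,\alpha_I)}\,\alpha_I,\qquad I=-1,0,1,\dots,\ell,$$ where $$\alpha_{-1}=\begin{pmatrix}1&0\\0&-1\end{pmatrix},\quad \alpha_0=\begin{pmatrix}-1&-\theta\\-\bar\theta&0\end{pmatrix},\quad \alpha_i=\begin{pmatrix}0&a_i\\\bar a_i&0\end{pmatrix}\ (1\le i\le\ell),$$ can be written as $$w_I(X)=M_I\,\bar X\,M_I^\dagger,\qquad I=-1,0,1,\dots,\ell.$$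
   Context: $\mathbb{K}$ is one of the four normed division algebras over $\mathbb{R}$ (real numbers, complex numbers, quaternions, octonions), with conjugation $a\mapsto\bar a$, norm $N(a)=a\bar a$, and positive definite form $(a,b)=a\bar b+b\bar a$. $a_1,\dots,a_\ell$ being simple roots of finite type means that $\big[2(a_i,a_j)/(a_j,a_j)\big]$ is the Cartan matrix of a finite root system. $H_2(\mathbb{K})$ is the real vector space of Hermitian matrices $X=\begin{pmatrix}x^+&z\\\bar z&x^-\end{pmatrix}$ with $x^\pm\in\mathbb{R}$, $z\in\mathbb{K}$, equipped with the quadratic form $\|X\|^2=-2\det X=-2(x^+x^--z\bar z)$ and the symmetric bilinear form $(X,Y)=\tfrac12(\|X+Y\|^2-\|X\|^2-\|Y\|^2)$. $M^\dagger$ is the conjugate transpose of $M$. For $\mathbb{K}=\mathbb{O}$ the triple matrix product $M_I\bar XM_I^\dagger$ is read with either choice of bracketing; the product is unambiguous because the entries of $M_I$ and $X$ together involve only two non-real octonions up to conjugation and $\mathbb{O}$ is alternative. *)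

theory Defs
  imports "HOL-Analysis.Analysis"
begin

section \<open>The algebras\<close>

text \<open>
  The library's ring classes require an associative product, so the octonions cannot be an instance
  of them. The class below is the class of (not necessarily associative) real star-algebras in which
  \<open>a + conjg a\<close> and \<open>a * conjg a\<close> are real and the latter is positive for \<open>a \<noteq> 0\<close>. It is
  closed under Cayley--Dickson doubling and therefore not restricted to the four
  division algebras; it serves to treat them uniformly.
\<close>

class nicely_normed_algebra = real_vector + times + one +
  fixes conjg :: "'a \<Rightarrow> 'a"
    and re :: "'a \<Rightarrow> real"
  assumes na_one_neq_zero: "1 \<noteq> 0"
    and na_one_left: "1 * a = a"
    and na_one_right: "a * 1 = a"
    and na_add_left: "(a + b) * c = a * c + b * c"
    and na_add_right: "a * (b + c) = a * b + a * c"
    and na_scaleR_left: "(r *\<^sub>R a) * b = r *\<^sub>R (a * b)"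
    and na_scaleR_right: "a * (r *\<^sub>R b) = r *\<^sub>R (a * b)"
    and conjg_conjg: "conjg (conjg a) = a"
    and conjg_add: "conjg (a + b) = conjg a + conjg b"
    and conjg_scaleR: "conjg (r *\<^sub>R a) = r *\<^sub>R conjg a"
    and conjg_mult: "conjg (a * b) = conjg b * conjg a"
    and add_conjg: "a + conjg a = (2 * re a) *\<^sub>R 1"
    and mult_conjg: "a * conjg a = re (a * conjg a) *\<^sub>R 1"
    and mult_conjg_commute: "conjg a * a = a * conjg a"
    and mult_conjg_pos: "a \<noteq> 0 \<Longrightarrow> re (a * conjg a) > 0"

lemma scaleR_one_eq_iff: "r *\<^sub>R (1 :: 'a::nicely_normed_algebra) = s *\<^sub>R 1 \<longleftrightarrow> r = s"
  by (simp add: na_one_neq_zero[where 'a = 'a])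

lemma re_add: "re (a + b) = re a + re b" for a :: "'a::nicely_normed_algebra"
proof -
  have "(2 * re (a + b)) *\<^sub>R (1 :: 'a) = (2 * re a) *\<^sub>R 1 + (2 * re b) *\<^sub>R 1"
    unfolding add_conjg[symmetric] conjg_add by (simp only: ac_simps)
  also have "\<dots> = (2 * re a + 2 * re b) *\<^sub>R 1"
    by (rule scaleR_left_distrib[symmetric])
  finally show ?thesis
    unfolding scaleR_one_eq_iff by simp
qed

lemma re_scaleR: "re (r *\<^sub>R a) = r * re a" for a :: "'a::nicely_normed_algebra"
proof -
  have "(2 * re (r *\<^sub>R a)) *\<^sub>R (1 :: 'a) = r *\<^sub>R ((2 * re a) *\<^sub>R 1)"
    by (simp only: add_conjg[symmetric] conjg_scaleR scaleR_right_distrib)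
  then have "(2 * re (r *\<^sub>R a)) *\<^sub>R (1 :: 'a) = (r * (2 * re a)) *\<^sub>R 1"
    by simp
  then show ?thesis
    unfolding scaleR_one_eq_iff by simp
qed

lemma na_zero_left: "0 * a = 0" for a :: "'a::nicely_normed_algebra"
  using na_scaleR_left[of 0 0 a] by simp

lemma na_zero_right: "a * 0 = 0" for a :: "'a::nicely_normed_algebra"
  using na_scaleR_right[of a 0 0] by simp

lemma na_minus_left: "(- a) * b = - (a * b)" for a :: "'a::nicely_normed_algebra"
  using na_scaleR_left[of "-1" a b] by simp

lemma na_minus_right: "a * (- b) = - (a * b)" for a :: "'a::nicely_normed_algebra"
  using na_scaleR_right[of a "-1" b] by simp

lemma conjg_zero: "conjg (0 :: 'a::nicely_normed_algebra) = 0"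
  using conjg_scaleR[of 0 "0 :: 'a"] by simp

lemma conjg_minus: "conjg (- a) = - conjg a"
  using conjg_scaleR[of "-1" a] by simp

lemma conjg_one: "conjg (1 :: 'a::nicely_normed_algebra) = 1"
  by (metis na_one_right conjg_conjg conjg_mult)

lemma re_one: "re (1 :: 'a::nicely_normed_algebra) = 1"
proof -
  have "(2 * re (1 :: 'a)) *\<^sub>R (1 :: 'a) = 2 *\<^sub>R 1"
    using add_conjg[of "1 :: 'a"] by (simp add: conjg_one scaleR_2)
  then show ?thesis
    unfolding scaleR_one_eq_iff by simp
qed

instantiation real :: nicely_normed_algebra
begin

definition conjg_real :: "real \<Rightarrow> real" where "conjg_real x = x"
definition re_real :: "real \<Rightarrow> real" where "re_real x = x"

instance
  by standard (auto simp: conjg_real_def re_real_def algebra_simps mult_neg_neg zero_less_mult_iff)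

end

instantiation complex :: nicely_normed_algebra
begin

definition conjg_complex :: "complex \<Rightarrow> complex" where "conjg_complex = cnj"
definition re_complex :: "complex \<Rightarrow> real" where "re_complex = Re"

instance
proof
  fix a :: complex
  assume "a \<noteq> 0"
  then show "re (a * conjg a) > 0"
    by (simp add: conjg_complex_def re_complex_def complex_eq_iff)
       (metis not_sum_squares_lt_zero linorder_neqE_linordered_idom sum_squares_eq_zero_iff)
qed (auto simp: conjg_complex_def re_complex_def complex_eq_iff algebra_simps)

end

subsection \<open>Cayley--Dickson doubling\<close>

text \<open>
  The convention is \<open>(a, b) * (c, d) = (a * c - conjg d * b, d * a + b * conjg c)\<close>; it turns
  \<open>complex\<close> into the quaternions and these into the octonions.
\<close>

datatype 'a cayley_dickson = CD (cd_fst: 'a) (cd_snd: 'a)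

instantiation cayley_dickson :: (nicely_normed_algebra) nicely_normed_algebra
begin

definition "0 = CD 0 0"
definition "1 = CD 1 0"
definition "x + y = CD (cd_fst x + cd_fst y) (cd_snd x + cd_snd y)"
definition "x - y = CD (cd_fst x - cd_fst y) (cd_snd x - cd_snd y)"
definition "- x = CD (- cd_fst x) (- cd_snd x)"
definition "r *\<^sub>R x = CD (r *\<^sub>R cd_fst x) (r *\<^sub>R cd_snd x)"
definition "x * y =
  CD (cd_fst x * cd_fst y - conjg (cd_snd y) * cd_snd x)
     (cd_snd y * cd_fst x + cd_snd x * conjg (cd_fst y))"
definition "conjg x = CD (conjg (cd_fst x)) (- cd_snd x)"
definition "re x = re (cd_fst x)"

lemmas cd_defs = zero_cayley_dickson_def one_cayley_dickson_def plus_cayley_dickson_def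
  minus_cayley_dickson_def uminus_cayley_dickson_def scaleR_cayley_dickson_def
  times_cayley_dickson_def conjg_cayley_dickson_def re_cayley_dickson_def

instance
proof
  fix x y z :: "'a cayley_dickson" and r s :: real
  note na = na_one_left na_one_right na_add_left na_add_right na_scaleR_left na_scaleR_right
    na_zero_left na_zero_right na_minus_left na_minus_right conjg_conjg conjg_add conjg_scaleR
    conjg_mult conjg_zero conjg_minus conjg_one
  have diff_left: "(a - b) * c = a * c - b * c" for a b c :: 'a
    using na_add_left[of a "- b" c] by (simp add: na)
  have diff_right: "c * (a - b) = c * a - c * b" for a b c :: 'a
    using na_add_right[of c a "- b"] by (simp add: na)
  have conjg_diff: "conjg (a - b) = conjg a - conjg b" for a b :: 'a
    using conjg_add[of a "- b"] by (simp add: na)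
  note na' = na diff_left diff_right conjg_diff
  have mc: "conjg x * x = x * conjg x"
    "x * conjg x = CD (cd_fst x * conjg (cd_fst x) + cd_snd x * conjg (cd_snd x)) 0" for x :: "'a cayley_dickson"
    by (simp_all add: cd_defs na' mult_conjg_commute)
  show "x + y + z = x + (y + z)" "x + y = y + x" "0 + x = x" "- x + x = 0" "x - y = x + - y"
    "r *\<^sub>R (x + y) = r *\<^sub>R x + r *\<^sub>R y" "(r + s) *\<^sub>R x = r *\<^sub>R x + s *\<^sub>R x"
    "r *\<^sub>R s *\<^sub>R x = (r * s) *\<^sub>R x" "1 *\<^sub>R x = x"
    by (simp_all add: cd_defs algebra_simps)
  show "(1 :: 'a cayley_dickson) \<noteq> 0" "1 * x = x" "x * 1 = x"
    "(x + y) * z = x * z + y * z" "x * (y + z) = x * y + x * z"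
    "(r *\<^sub>R x) * y = r *\<^sub>R (x * y)" "x * (r *\<^sub>R y) = r *\<^sub>R (x * y)"
    "conjg (conjg x) = x" "conjg (x + y) = conjg x + conjg y" "conjg (r *\<^sub>R x) = r *\<^sub>R conjg x"
    "conjg (x * y) = conjg y * conjg x"
    by (simp_all add: cd_defs na' na_one_neq_zero algebra_simps)
  show "x + conjg x = (2 * re x) *\<^sub>R 1"
    by (simp add: cd_defs add_conjg)
  show "x * conjg x = re (x * conjg x) *\<^sub>R 1"
    unfolding mc(2)
    by (simp add: re_cayley_dickson_def one_cayley_dickson_def scaleR_cayley_dickson_def
        re_add scaleR_left_distrib mult_conjg[symmetric])
  show "conjg x * x = x * conjg x"
    by (rule mc(1))
  have nonneg: "re (a * conjg a) \<ge> 0" for a :: 'a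
    using mult_conjg_pos[of a] re_scaleR[of 0 "0 :: 'a"]
    by (cases "a = 0") (auto simp: na_zero_left)
  assume "x \<noteq> 0"
  then have "cd_fst x \<noteq> 0 \<or> cd_snd x \<noteq> 0"
    by (metis cayley_dickson.collapse zero_cayley_dickson_def)
  then show "re (x * conjg x) > 0"
    unfolding mc(2) using nonneg[of "cd_fst x"] nonneg[of "cd_snd x"]
    by (auto simp: re_cayley_dickson_def re_add add_pos_nonneg add_nonneg_pos mult_conjg_pos)
qed

end

type_synonym quaternion = "complex cayley_dickson"
type_synonym octonion = "quaternion cayley_dickson"

lemma dim_cayley_dickson:
  assumes "finite B" "independent B" "span B = (UNIV :: 'a::nicely_normed_algebra set)"
  shows "dim (UNIV :: 'a cayley_dickson set) = 2 * dim (UNIV :: 'a set)" (is ?dim)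
    and "\<exists>C. finite C \<and> independent C \<and> span C = (UNIV :: 'a cayley_dickson set)" (is ?basis)
proof -
  define f g :: "'a \<Rightarrow> 'a cayley_dickson" where "f a = CD a 0" and "g a = CD 0 a" for a
  have lin: "linear f" "linear g"
    by (auto intro!: linearI simp: f_def g_def cd_defs)
  have inj: "inj f" "inj g"
    by (auto simp: inj_def f_def g_def)
  define C where "C = f ` B \<union> g ` B"
  have ind: "independent (f ` B)" "independent (g ` B)"
    using linear_independent_injective_image[OF lin(1) assms(2)]
      linear_independent_injective_image[OF lin(2) assms(2)] inj
    by (simp_all add: assms(3))
  have sp: "span (f ` B) = range f" "span (g ` B) = range g"
    using lin assms(3) by (simp_all add: linear_span_image)
  have int: "range f \<inter> range g = {0}"
    by (auto simp: f_def g_def cd_defs)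
  have zero: "0 \<notin> f ` B" using ind(1) dependent_zero[of "f ` B"] by auto
  have disj: "f ` B \<inter> g ` B = {}"
  proof (rule ccontr)
    assume "f ` B \<inter> g ` B \<noteq> {}"
    then obtain v where v: "v \<in> f ` B" "v \<in> g ` B" by auto
    then have "v \<in> range f \<inter> range g" by auto
    then show False using v zero unfolding int by simp
  qed
  have spanC: "span C = UNIV"
  proof -
    have "x \<in> span C" for x
    proof -
      have "f (cd_fst x) \<in> span C" "g (cd_snd x) \<in> span C"
        using sp span_mono[of "f ` B" C] span_mono[of "g ` B" C] by (auto simp: C_def)
      then have "f (cd_fst x) + g (cd_snd x) \<in> span C"
        by (rule span_add)
      then show ?thesis by (simp add: f_def g_def cd_defs)
    qed
    then show ?thesis by blast
  qed
  have finC: "finite C" using assms(1) by (simp add: C_def)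
  have cardC: "card C = 2 * card B"
    unfolding C_def using assms(1) disj inj
    by (simp add: card_Un_disjoint card_image inj_on_subset)
  have indC: "independent C"
    unfolding independent_explicit_finite_subsets
  proof (intro allI impI ballI)
    fix S u v
    assume S: "S \<subseteq> C" "finite S" and s0: "(\<Sum>v\<in>S. u v *\<^sub>R v) = 0" and v: "v \<in> S"
    let ?F = "S \<inter> f ` B" and ?G = "S \<inter> g ` B"
    have SFG: "S = ?F \<union> ?G" using S by (auto simp: C_def)
    have eq: "(\<Sum>v\<in>?F. u v *\<^sub>R v) + (\<Sum>v\<in>?G. u v *\<^sub>R v) = 0"
    proof -
      have "finite ?F" "finite ?G" "?F \<inter> ?G = {}" using S(2) disj by auto
      from sum.union_disjoint[OF this, of "\<lambda>v. u v *\<^sub>R v"] s0 SFG show ?thesis by simp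
    qed
    have inF: "(\<Sum>v\<in>?F. u v *\<^sub>R v) \<in> range f"
      unfolding sp(1)[symmetric] by (intro span_sum span_scale span_base) auto
    have inG: "(\<Sum>v\<in>?G. u v *\<^sub>R v) \<in> range g"
      unfolding sp(2)[symmetric] by (intro span_sum span_scale span_base) auto
    obtain p q where pq: "(\<Sum>v\<in>?F. u v *\<^sub>R v) = f p" "(\<Sum>v\<in>?G. u v *\<^sub>R v) = g q"
      using inF inG by (elim rangeE)
    from eq have "p = 0" "q = 0"
      unfolding pq by (simp_all add: f_def g_def cd_defs)
    then have zeros: "(\<Sum>v\<in>?F. u v *\<^sub>R v) = 0" "(\<Sum>v\<in>?G. u v *\<^sub>R v) = 0"
      using pq by (simp_all add: f_def g_def cd_defs)
    have fin: "finite ?F" "finite ?G" using S(2) by simp_all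
    from v SFG consider "v \<in> ?F" | "v \<in> ?G" by auto
    then show "u v = 0"
    proof cases
      case 1
      show ?thesis by (rule independentD[OF ind(1) fin(1) _ zeros(1) 1]) simp
    next
      case 2
      show ?thesis by (rule independentD[OF ind(2) fin(2) _ zeros(2) 2]) simp
    qed
  qed
  show ?basis using finC indC spanC by blast
  show ?dim using dim_eq_card[of C UNIV] dim_eq_card[of B UNIV] spanC assms indC cardC by simp
qed

lemma dim_division_algebras:
  shows dim_real: "dim (UNIV :: real set) = 1"
    and dim_complex: "dim (UNIV :: complex set) = 2"
    and dim_quaternion: "dim (UNIV :: quaternion set) = 4"
    and dim_octonion: "dim (UNIV :: octonion set) = 8"
proof -
  show "dim (UNIV :: real set) = 1" "dim (UNIV :: complex set) = 2" by simp_all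
  obtain B :: "complex set" where B: "finite B" "independent B" "span B = UNIV"
    using independent_Basis span_Basis finite_Basis by blast
  from dim_cayley_dickson[OF this] show q: "dim (UNIV :: quaternion set) = 4" by simp
  from dim_cayley_dickson(2)[OF B] obtain C :: "quaternion set"
    where "finite C" "independent C" "span C = UNIV" by blast
  from dim_cayley_dickson(1)[OF this] q show "dim (UNIV :: octonion set) = 8" by simp
qed

definition qnorm :: "'k::nicely_normed_algebra \<Rightarrow> real"  \<comment> \<open>\<open>N(a)\<close>\<close>
  where "qnorm a = re (a * conjg a)"

lemma qnorm_eq: "qnorm a *\<^sub>R 1 = a * conjg a"
  unfolding qnorm_def by (rule mult_conjg[symmetric])

lemma quaternion_cases:
  fixes x :: quaternion
  obtains a b c d where "x = CD (Complex a b) (Complex c d)"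
  by (metis cayley_dickson.exhaust complex.exhaust)

lemma quaternion_mult_assoc: "(x * y) * z = x * (y * z)" for x y z :: quaternion
  by (simp add: cd_defs conjg_complex_def algebra_simps)

lemma re_mult_commute_quaternion: "re (x * y) = re (y * x)" for x y :: quaternion
  by (simp add: cd_defs conjg_complex_def re_complex_def algebra_simps)

lemma qnorm_mult_quaternion: "qnorm (x * y) = qnorm x * qnorm y" for x y :: quaternion
proof -
  have N: "qnorm (CD (Complex a b) (Complex c d)) = a\<^sup>2 + b\<^sup>2 + c\<^sup>2 + d\<^sup>2" for a b c d
    by (simp add: qnorm_def cd_defs conjg_complex_def re_complex_def power2_eq_square)
  obtain a b c d where x: "x = CD (Complex a b) (Complex c d)"
    by (rule quaternion_cases)
  obtain a' b' c' d' where y: "y = CD (Complex a' b') (Complex c' d')"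
    by (rule quaternion_cases)
  have xy: "x * y =
      CD (Complex (a * a' - b * b' - (c' * c + d' * d)) (a * b' + b * a' - (c' * d - d' * c)))
         (Complex (c' * a - d' * b + (c * a' + d * b')) (c' * b + d' * a + (d * a' - c * b')))"
    by (simp add: x y cd_defs conjg_complex_def complex_eq_iff)
  show ?thesis
    unfolding xy unfolding x y N by algebra
qed

lemma re_conjg: "re (conjg a) = re a" for a :: "'a::nicely_normed_algebra"
proof -
  have "(2 * re (conjg a)) *\<^sub>R (1 :: 'a) = (2 * re a) *\<^sub>R 1"
    unfolding add_conjg[symmetric] conjg_conjg by (rule add.commute)
  then show ?thesis
    unfolding scaleR_one_eq_iff by simp
qed

lemma re_minus: "re (- a) = - re a" for a :: "'a::nicely_normed_algebra"
  using re_scaleR[of "-1" a] by simp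

lemma qnorm_conjg: "qnorm (conjg a) = qnorm a"
  by (simp add: qnorm_def conjg_conjg mult_conjg_commute)

lemma qnorm_minus: "qnorm (- a) = qnorm a"
  by (simp add: qnorm_def conjg_minus na_minus_left na_minus_right)

lemma qnorm_add: "qnorm (a + b) = qnorm a + qnorm b + 2 * re (a * conjg b)"
proof -
  have "re (b * conjg a) = re (a * conjg b)"
    using re_conjg[of "a * conjg b"] by (simp add: conjg_mult conjg_conjg)
  then show ?thesis
    by (simp add: qnorm_def conjg_add na_add_left na_add_right re_add)
qed

lemma qnorm_CD: "qnorm (CD a b) = qnorm a + qnorm b"
  by (simp add: qnorm_def cd_defs conjg_minus na_minus_left mult_conjg_commute re_add)

lemma qnorm_mult_octonion: "qnorm (x * y) = qnorm x * qnorm y" for x y :: octonion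
proof -
  obtain a b c d where x: "x = CD a b" and y: "y = CD c d"
    by (metis cayley_dickson.exhaust)
  have "re (a * c * conjg (conjg d * b)) = re ((a * c * conjg b) * d)"
    by (simp add: conjg_mult conjg_conjg quaternion_mult_assoc)
  also have "\<dots> = re (d * a * conjg (b * conjg c))"
    unfolding re_mult_commute_quaternion[of "a * c * conjg b"]
    by (simp add: conjg_mult conjg_conjg quaternion_mult_assoc)
  finally have cross: "re (a * c * conjg (conjg d * b)) = re (d * a * conjg (b * conjg c))" .
  have "x * y = CD (a * c + - (conjg d * b)) (d * a + b * conjg c)"
    by (simp add: x y times_cayley_dickson_def[of "CD a b"])
  then have "qnorm (x * y) = qnorm (a * c + - (conjg d * b)) + qnorm (d * a + b * conjg c)"
    by (simp only: qnorm_CD)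
  also have "\<dots> = qnorm a * qnorm c + qnorm d * qnorm b + (qnorm d * qnorm a + qnorm b * qnorm c)"
    unfolding qnorm_add conjg_minus na_minus_right re_minus qnorm_minus cross
      qnorm_mult_quaternion qnorm_conjg by simp
  also have "\<dots> = qnorm x * qnorm y"
    unfolding x y qnorm_CD by (simp add: algebra_simps)
  finally show ?thesis .
qed

definition form :: "'k::nicely_normed_algebra \<Rightarrow> 'k \<Rightarrow> real"
  where "form a b = re (a * conjg b + b * conjg a)"

lemma form_eq: "form a b *\<^sub>R 1 = a * conjg b + b * conjg a"
proof -
  have "a * conjg b + b * conjg a = a * conjg b + conjg (a * conjg b)"
    by (simp add: conjg_mult conjg_conjg)
  then have "a * conjg b + b * conjg a = (2 * re (a * conjg b)) *\<^sub>R 1"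
    by (simp only: add_conjg)
  then show ?thesis
    unfolding form_def by (simp add: re_scaleR re_one)
qed


section \<open>Root systems in the Euclidean space of an algebra\<close>

definition cartan_int :: "'k::nicely_normed_algebra \<Rightarrow> 'k \<Rightarrow> real"
  where "cartan_int b a = 2 * form b a / form a a"

definition finite_root_system :: "'k::nicely_normed_algebra set \<Rightarrow> bool"
  where "finite_root_system \<Phi> \<longleftrightarrow>
    finite \<Phi> \<and> 0 \<notin> \<Phi> \<and> span \<Phi> = UNIV \<and>
    (\<forall>a\<in>\<Phi>. \<forall>b\<in>\<Phi>. b - cartan_int b a *\<^sub>R a \<in> \<Phi>) \<and>
    (\<forall>a\<in>\<Phi>. \<forall>b\<in>\<Phi>. cartan_int b a \<in> \<int>) \<and>
    (\<forall>a\<in>\<Phi>. \<forall>r. r *\<^sub>R a \<in> \<Phi> \<longrightarrow> r = 1 \<or> r = -1)"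

definition simple_system :: "'k::nicely_normed_algebra set \<Rightarrow> (nat \<Rightarrow> 'k) \<Rightarrow> bool"
  where "simple_system \<Phi> b \<longleftrightarrow>
    inj_on b {1..dim (UNIV :: 'k set)} \<and>
    b ` {1..dim (UNIV :: 'k set)} \<subseteq> \<Phi> \<and>
    independent (b ` {1..dim (UNIV :: 'k set)}) \<and>
    (\<forall>c\<in>\<Phi>. \<exists>n :: nat \<Rightarrow> nat.
      c = (\<Sum>i=1..dim (UNIV :: 'k set). real (n i) *\<^sub>R b i) \<or>
      c = - (\<Sum>i=1..dim (UNIV :: 'k set). real (n i) *\<^sub>R b i))"

text \<open>
  A rank \<open>\<ell>\<close> finite root system may be realised in any Euclidean space of dimension
  \<open>\<ell>\<close> without changing its Cartan matrix, so it is no restriction that \<open>\<Phi>\<close> lives in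
  \<open>'k\<close> itself.
\<close>

definition simple_roots_of_finite_type :: "(nat \<Rightarrow> 'k::nicely_normed_algebra) \<Rightarrow> bool"
  where "simple_roots_of_finite_type a \<longleftrightarrow>
    (\<exists>(\<Phi> :: 'k set) b. finite_root_system \<Phi> \<and> simple_system \<Phi> b \<and>
      (\<forall>i\<in>{1..dim (UNIV :: 'k set)}. \<forall>j\<in>{1..dim (UNIV :: 'k set)}.
        cartan_int (a i) (a j) = cartan_int (b i) (b j)))"

lemma simple_system_imp_simple_roots_of_finite_type:
  "finite_root_system \<Phi> \<Longrightarrow> simple_system \<Phi> a \<Longrightarrow> simple_roots_of_finite_type a"
  unfolding simple_roots_of_finite_type_def by blast

text \<open>The root system determined by its simple roots: their orbit under the Weyl group.\<close>

inductive_set roots :: "(nat \<Rightarrow> 'k::nicely_normed_algebra) \<Rightarrow> 'k set"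
  for a :: "nat \<Rightarrow> 'k"
  where
    simple: "i \<in> {1..dim (UNIV :: 'k set)} \<Longrightarrow> a i \<in> roots a"
  | reflect: "b \<in> roots a \<Longrightarrow> i \<in> {1..dim (UNIV :: 'k set)} \<Longrightarrow>
      b - cartan_int b (a i) *\<^sub>R a i \<in> roots a"

text \<open>
  A root dominating all the others exists only if the root system is irreducible.
\<close>

definition highest_root :: "(nat \<Rightarrow> 'k::nicely_normed_algebra) \<Rightarrow> 'k \<Rightarrow> bool"
  where "highest_root a \<theta> \<longleftrightarrow> \<theta> \<in> roots a \<and>
    (\<forall>b\<in>roots a. \<exists>n :: nat \<Rightarrow> nat. \<theta> - b = (\<Sum>i=1..dim (UNIV :: 'k set). real (n i) *\<^sub>R a i))"


section \<open>Matrices of size two\<close>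

text \<open>
  The library's matrix product and determinant need an associative, respectively commutative,
  ring of entries.
\<close>

definition mat22 :: "'k \<Rightarrow> 'k \<Rightarrow> 'k \<Rightarrow> 'k \<Rightarrow> 'k::nicely_normed_algebra^2^2"
  where "mat22 p q r s = vector [vector [p, q], vector [r, s]]"

definition mat_mul :: "'k::nicely_normed_algebra^2^2 \<Rightarrow> 'k^2^2 \<Rightarrow> 'k^2^2"  (infixl "\<odot>" 70)
  where "A \<odot> B = (\<chi> i j. \<Sum>k\<in>UNIV. A$i$k * B$k$j)"

definition mat_conjg :: "'k::nicely_normed_algebra^2^2 \<Rightarrow> 'k^2^2"
  where "mat_conjg A = (\<chi> i j. conjg (A$i$j))"

definition dagger :: "'k::nicely_normed_algebra^2^2 \<Rightarrow> 'k^2^2"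
  where "dagger A = (\<chi> i j. conjg (A$j$i))"

definition H2 :: "('k::nicely_normed_algebra^2^2) set"
  where "H2 = {mat22 (xp *\<^sub>R 1) z (conjg z) (xm *\<^sub>R 1) | xp xm z. True}"

text \<open>The determinant is only used on \<open>H2\<close>, where the argument of \<open>re\<close> below is real.\<close>

definition herm_det :: "'k::nicely_normed_algebra^2^2 \<Rightarrow> real"
  where "herm_det X = re (X$1$1 * X$2$2 - X$1$2 * X$2$1)"

lemma herm_det_H2:
  "herm_det (mat22 (xp *\<^sub>R 1) z (conjg z) (xm *\<^sub>R 1)) = xp * xm - qnorm z"
proof -
  have "re (a - b) = re a - re b" for a b :: 'a
    using re_add[of "a - b" b] by simp
  then show ?thesis
    by (simp add: herm_det_def mat22_def qnorm_def na_scaleR_left na_one_left re_scaleR re_one)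
qed

definition sqnorm :: "'k::nicely_normed_algebra^2^2 \<Rightarrow> real"
  where "sqnorm X = - 2 * herm_det X"

definition bil :: "'k::nicely_normed_algebra^2^2 \<Rightarrow> 'k^2^2 \<Rightarrow> real"
  where "bil X Y = (sqnorm (X + Y) - sqnorm X - sqnorm Y) / 2"

definition simple_root_mat ::
    "(nat \<Rightarrow> 'k::nicely_normed_algebra) \<Rightarrow> 'k \<Rightarrow> int \<Rightarrow> 'k^2^2"
  where "simple_root_mat a \<theta> I =
    (if I = -1 then mat22 1 0 0 (-1)
     else if I = 0 then mat22 (-1) (-\<theta>) (- conjg \<theta>) 0
     else mat22 0 (a (nat I)) (conjg (a (nat I))) 0)"

definition simple_reflection ::
    "(nat \<Rightarrow> 'k::nicely_normed_algebra) \<Rightarrow> 'k \<Rightarrow> int \<Rightarrow> 'k^2^2 \<Rightarrow> 'k^2^2"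
  where "simple_reflection a \<theta> I X =
    X - (2 * bil X (simple_root_mat a \<theta> I) /
         bil (simple_root_mat a \<theta> I) (simple_root_mat a \<theta> I)) *\<^sub>R simple_root_mat a \<theta> I"

definition unit_root :: "(nat \<Rightarrow> 'k::nicely_normed_algebra) \<Rightarrow> nat \<Rightarrow> 'k"
  where "unit_root a i = a i /\<^sub>R sqrt (qnorm (a i))"

definition refl_mat ::
    "(nat \<Rightarrow> 'k::nicely_normed_algebra) \<Rightarrow> 'k \<Rightarrow> int \<Rightarrow> 'k^2^2"
  where "refl_mat a \<theta> I =
    (if I = -1 then mat22 0 1 1 0
     else if I = 0 then mat22 (-\<theta>) 1 0 (conjg \<theta>)
     else mat22 (unit_root a (nat I)) 0 0 (- conjg (unit_root a (nat I))))"

end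

theory Submission
  imports Defs
begin

text \<open>
  The reflection of a star-algebra in an element \<open>u\<close> with \<open>N(u) = 1\<close> is
  \<open>z \<mapsto> z - (z, u) u = z - (z * conjg u + u * conjg z) * u\<close>. If \<open>(z * conjg u) * u = z\<close>, only
  \<open>- (u * conjg z) * u\<close> survives (\<open>reflection_unit\<close>). This cancellation, and the independence of
  \<open>u * conjg z * u\<close> from the bracketing (\<open>flexible\<close>), which is needed to conjugate this formula for
  the lower left entry of a Hermitian matrix, are consequences of alternativity.

  The reflections of Hermitian matrices reduce to this. On \<open>H2\<close> the bilinear
  form is \<open>(z, w)\<close> on the off-diagonal entries minus the hyperbolic pairing of the diagonals
  (\<open>bil_herm\<close>). So the reflection for \<open>I = -1\<close> merely exchanges the diagonal entries; that for
  \<open>I \<ge> 1\<close> fixes them and reflects \<open>z\<close> in \<open>a\<^sub>I\<close>; that for \<open>I = 0\<close> is an affine version, where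
  \<open>z\<close> is reflected in \<open>\<theta>\<close> and then translated by \<open>x\<^sup>- \<theta>\<close>. Multiplying out the matrix products
  gives the same entries, in either bracketing.

  The root \<open>\<theta>\<close> is a unit by its normalization. Every \<open>a\<^sub>i\<close> can be normalized to a unit because the
  diagonal entries of the Cartan matrix are \<open>2\<close>, which forces \<open>a\<^sub>i\<close> to be nonzero
  (\<open>simple_root_nonzero\<close>).

  That the four algebras are alternative follows from the Cayley--Dickson construction: doubling
  turns commutative associative algebras, such as \<open>complex\<close>, into associative ones, and these into
  alternative ones.
\<close>

section \<open>Commutative, associative and alternative star-algebras\<close>

text \<open>
  The rungs of the Cayley--Dickson ladder. Only left alternativity is an axiom, since the
  conjugation turns it into right alternativity.
\<close>

class alternative_algebra = nicely_normed_algebra +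
  assumes left_alternative: "(x * x) * y = x * (x * y)"

class associative_algebra = nicely_normed_algebra +
  assumes na_assoc: "(x * y) * z = x * (y * z)"
begin

subclass alternative_algebra
  by standard (rule na_assoc)

end

class commutative_algebra = associative_algebra +
  assumes na_commute: "x * y = y * x"

instance real :: commutative_algebra
  by standard simp_all

instance complex :: commutative_algebra
  by standard simp_all

lemmas na_simps = na_one_left na_one_right na_add_left na_add_right na_scaleR_left
  na_scaleR_right na_zero_left na_zero_right na_minus_left na_minus_right conjg_conjg conjg_add
  conjg_scaleR conjg_mult conjg_zero conjg_minus conjg_one

lemma na_diff_left: "(a - b) * c = a * c - b * c" for a :: "'a::nicely_normed_algebra"
  using na_add_left[of a "- b" c] by (simp add: na_minus_left)

lemma na_diff_right: "c * (a - b) = c * a - c * b" for a :: "'a::nicely_normed_algebra"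
  using na_add_right[of c a "- b"] by (simp add: na_minus_right)

lemma conjg_diff: "conjg (a - b) = conjg a - conjg b" for a :: "'a::nicely_normed_algebra"
  using conjg_add[of a "- b"] by (simp add: conjg_minus)

lemma conjg_eq: "conjg a = (2 * re a) *\<^sub>R 1 - a" for a :: "'a::nicely_normed_algebra"
  using add_conjg[of a] by (simp add: algebra_simps)

lemma mult_conjg_eq: "a * conjg a = qnorm a *\<^sub>R 1" "conjg a * a = qnorm a *\<^sub>R 1"
  for a :: "'a::nicely_normed_algebra"
  by (simp_all add: mult_conjg_commute qnorm_eq)

instance cayley_dickson :: (commutative_algebra) associative_algebra
proof
  have left_commute: "a * (b * c) = b * (a * c)" for a b c :: 'a
    by (metis na_assoc na_commute)
  show "(x * y) * z = x * (y * z)" for x y z :: "'a cayley_dickson"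
    by (simp add: times_cayley_dickson_def na_simps na_diff_left na_diff_right conjg_diff
        na_assoc na_commute left_commute algebra_simps)
qed

text \<open>
  For \<open>x = (a, b)\<close>, the components of \<open>(x * x) * y\<close> and \<open>x * (x * y)\<close> contain the same products
  up to the position of factors \<open>a + conjg a\<close> and \<open>b * conjg b = conjg b * b\<close>. These are real,
  hence central.
\<close>

instance cayley_dickson :: (associative_algebra) alternative_algebra
proof
  fix x y :: "'a cayley_dickson"
  obtain a b c d where x: "x = CD a b" and y: "y = CD c d"
    by (metis cayley_dickson.exhaust)
  have b: "conjg b * (b * u) = qnorm b *\<^sub>R u" "b * (conjg b * u) = qnorm b *\<^sub>R u" for u
    by (simp_all add: na_assoc[symmetric] mult_conjg_eq na_simps)
  show "(x * x) * y = x * (x * y)"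
    by (simp add: x y times_cayley_dickson_def na_simps na_diff_left na_diff_right conjg_diff
        na_assoc b mult_conjg_eq conjg_eq[of a] scaleR_left_distrib[symmetric] algebra_simps)
qed

section \<open>Reflections in an alternative algebra\<close>

lemma right_alternative: "y * (x * x) = (y * x) * x" for x :: "'a::alternative_algebra"
proof -
  have "conjg ((conjg x * conjg x) * conjg y) = conjg (conjg x * (conjg x * conjg y))"
    by (simp only: left_alternative)
  then show ?thesis
    by (simp add: conjg_mult conjg_conjg)
qed

lemma mult_conjg_cancel_right: "(z * conjg u) * u = qnorm u *\<^sub>R z"
  for u :: "'a::alternative_algebra"
proof -
  have "(z * conjg u) * u = z * (conjg u * u)"
    by (simp add: conjg_eq na_diff_left na_diff_right na_simps right_alternative)
  then show ?thesis
    by (simp add: mult_conjg_eq na_simps)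
qed

text \<open>
  Linearizing the left alternative law in \<open>x\<close> makes the associator skew-symmetric in its first two
  arguments; by the right alternative law, it then vanishes at \<open>(x, y, x)\<close>.
\<close>

lemma flexible: "(x * y) * x = x * (y * x)" for x :: "'a::alternative_algebra"
proof -
  have "((x + y) * (x + y)) * x = (x + y) * ((x + y) * x)"
    by (rule left_alternative)
  then have "(x * y) * x + (y * x) * x = x * (y * x) + y * (x * x)"
    using left_alternative[of x x] left_alternative[of y x] by (simp add: na_simps algebra_simps)
  then show ?thesis
    by (simp add: right_alternative)
qed

lemma reflection_unit: "z - form z u *\<^sub>R u = - ((u * conjg z) * u)" if "qnorm u = 1"
  for u :: "'a::alternative_algebra"
proof -
  have "form z u *\<^sub>R u = (z * conjg u + u * conjg z) * u"
    by (simp only: form_eq[symmetric] na_scaleR_left na_one_left)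
  then show ?thesis
    by (simp add: na_add_left mult_conjg_cancel_right that)
qed

lemma form_scaleR_right: "form z (r *\<^sub>R u) = r * form z u"
  for u :: "'a::nicely_normed_algebra"
  by (simp add: form_def conjg_scaleR na_scaleR_left na_scaleR_right re_add re_scaleR algebra_simps)

lemma form_self: "form u u = 2 * qnorm u" for u :: "'a::nicely_normed_algebra"
  by (simp add: form_def qnorm_def re_add)

lemma qnorm_scaleR: "qnorm (r *\<^sub>R u) = r\<^sup>2 * qnorm u" for u :: "'a::nicely_normed_algebra"
  by (simp add: qnorm_def conjg_scaleR na_scaleR_left na_scaleR_right re_scaleR power2_eq_square)

lemma qnorm_zero: "qnorm (0 :: 'a::nicely_normed_algebra) = 0"
  using qnorm_scaleR[of 0 "0 :: 'a"] by simp

lemma qnorm_pos: "u \<noteq> 0 \<Longrightarrow> qnorm u > 0" for u :: "'a::nicely_normed_algebra"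
  unfolding qnorm_def by (rule mult_conjg_pos)

lemma qnorm_unit_root: "qnorm (unit_root a i) = 1" if "a i \<noteq> 0"
  using qnorm_pos[OF that] by (simp add: unit_root_def qnorm_scaleR field_simps)

lemma form_unit_root: "form z (unit_root a i) *\<^sub>R unit_root a i = (form z (a i) / qnorm (a i)) *\<^sub>R a i"
  if "a i \<noteq> 0"
  using qnorm_pos[OF that]
  by (simp add: unit_root_def form_scaleR_right field_simps flip: power2_eq_square)

text \<open>
  The diagonal entries of the Cartan matrix are \<open>2\<close>, whereas \<open>a i = 0\<close> would make the
  \<open>i\<close>-th one \<open>0\<close>, by the convention \<open>x / 0 = 0\<close>.
\<close>

lemma simple_root_nonzero:
  fixes a :: "nat \<Rightarrow> 'k::nicely_normed_algebra"
  assumes "simple_roots_of_finite_type a" "i \<in> {1..dim (UNIV :: 'k set)}"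
  shows "a i \<noteq> 0"
proof -
  obtain \<Phi> :: "'k set" and b where "finite_root_system \<Phi>" "simple_system \<Phi> b"
    and eq: "cartan_int (a i) (a i) = cartan_int (b i) (b i)"
    using assms unfolding simple_roots_of_finite_type_def by blast
  then have "b i \<in> \<Phi>" "0 \<notin> \<Phi>"
    using assms(2) unfolding finite_root_system_def simple_system_def by blast+
  then have "b i \<noteq> 0"
    by metis
  then have "cartan_int (a i) (a i) = 2"
    unfolding eq using qnorm_pos[of "b i"] by (simp add: cartan_int_def form_self)
  then show ?thesis
    by (auto simp: cartan_int_def form_self qnorm_zero)
qed

section \<open>Hermitian matrices\<close>

definition herm :: "real \<Rightarrow> 'k \<Rightarrow> real \<Rightarrow> 'k::nicely_normed_algebra^2^2"
  where "herm p z m = mat22 (p *\<^sub>R 1) z (conjg z) (m *\<^sub>R 1)"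

lemma H2_eq: "H2 = {herm p z m | p z m. True}"
  unfolding H2_def herm_def by blast

lemma mat22_nth:
  "mat22 p q r s $ 1 $ 1 = p" "mat22 p q r s $ 1 $ 2 = q"
  "mat22 p q r s $ 2 $ 1 = r" "mat22 p q r s $ 2 $ 2 = s"
  by (simp_all add: mat22_def)

lemma mat22_ops:
  "mat22 p q r s + mat22 p' q' r' s' = mat22 (p + p') (q + q') (r + r') (s + s')"
  "mat22 p q r s - mat22 p' q' r' s' = mat22 (p - p') (q - q') (r - r') (s - s')"
  "c *\<^sub>R mat22 p q r s = mat22 (c *\<^sub>R p) (c *\<^sub>R q) (c *\<^sub>R r) (c *\<^sub>R s)"
  "mat22 p q r s \<odot> mat22 p' q' r' s' =
    mat22 (p * p' + q * r') (p * q' + q * s') (r * p' + s * r') (r * q' + s * s')"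
  "mat_conjg (mat22 p q r s) = mat22 (conjg p) (conjg q) (conjg r) (conjg s)"
  "dagger (mat22 p q r s) = mat22 (conjg p) (conjg r) (conjg q) (conjg s)"
  by (simp_all add: vec_eq_iff forall_2 mat22_nth mat_mul_def sum_2 mat_conjg_def dagger_def)

lemma herm_ops:
  "herm p z m + herm p' z' m' = herm (p + p') (z + z') (m + m')"
  "herm p z m - herm p' z' m' = herm (p - p') (z - z') (m - m')"
  "c *\<^sub>R herm p z m = herm (c * p) (c *\<^sub>R z) (c * m)"
  by (simp_all add: herm_def mat22_ops conjg_add conjg_diff conjg_scaleR scaleR_left_distrib
      scaleR_left_diff_distrib)

lemma bil_herm: "bil (herm p z m) (herm p' z' m') = form z z' - (p * m' + m * p')"
proof -
  have form: "form z z' = 2 * re (z * conjg z')"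
    unfolding form_def re_add using re_conjg[of "z * conjg z'"]
    by (simp add: conjg_mult conjg_conjg)
  have sqnorm: "sqnorm (herm p z m) = 2 * (qnorm z - p * m)" for p m and z :: 'a
    by (simp add: sqnorm_def herm_def herm_det_H2)
  show ?thesis
    unfolding bil_def herm_ops sqnorm qnorm_add form by (simp add: field_simps)
qed

lemma simple_root_mat_herm:
  "simple_root_mat a \<theta> (-1) = herm 1 0 (-1)"
  "simple_root_mat a \<theta> 0 = herm (-1) (- \<theta>) 0"
  "I > 0 \<Longrightarrow> simple_root_mat a \<theta> I = herm 0 (a (nat I)) 0"
  by (simp_all add: simple_root_mat_def herm_def conjg_zero conjg_minus)

section \<open>The simple reflections as matrix products\<close>

lemma form_zero_right: "form z 0 = 0" for z :: "'a::nicely_normed_algebra"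
  using form_scaleR_right[of z 0 0] by simp

lemma form_minus_right: "form z (- u) = - form z u" for z :: "'a::nicely_normed_algebra"
  using form_scaleR_right[of z "-1" u] by simp

lemma simple_reflection_herm:
  "simple_reflection a \<theta> (-1) (herm p z m) = herm m z p"
  "qnorm \<theta> = 1 \<Longrightarrow> simple_reflection a \<theta> 0 (herm p z m) =
    herm (p + m - form z \<theta>) (z - form z \<theta> *\<^sub>R \<theta> + m *\<^sub>R \<theta>) m"
  "I > 0 \<Longrightarrow> simple_reflection a \<theta> I (herm p z m) =
    herm p (z - (form z (a (nat I)) / qnorm (a (nat I))) *\<^sub>R a (nat I)) m"
  by (simp_all add: simple_reflection_def simple_root_mat_herm bil_herm herm_ops form_zero_right
      form_minus_right form_self qnorm_zero qnorm_minus diff_divide_distrib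
      scaleR_left_diff_distrib algebra_simps)

text \<open>
  The twisted conjugation of \<open>X\<close> by a diagonal matrix, respectively by a triangular one,
  whose entries lie in the algebra generated by a unit \<open>u\<close>. The lower left entry is the conjugate of
  the upper right one with the opposite bracketing.
\<close>

lemma diagonal_product_herm:
  fixes u :: "'k::alternative_algebra"
  assumes "qnorm u = 1"
  defines "M \<equiv> mat22 u 0 0 (- conjg u)"
  shows "(M \<odot> mat_conjg (herm p z m)) \<odot> dagger M = herm p (z - form z u *\<^sub>R u) m"
    and "M \<odot> (mat_conjg (herm p z m) \<odot> dagger M) = herm p (z - form z u *\<^sub>R u) m"
  unfolding reflection_unit[OF assms(1)] M_def
  by (simp_all add: herm_def mat22_ops na_simps mult_conjg_eq flexible assms(1))

lemma triangular_product_herm: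
  fixes u :: "'k::alternative_algebra"
  assumes "qnorm u = 1"
  defines "M \<equiv> mat22 (- u) 1 0 (conjg u)"
  shows "(M \<odot> mat_conjg (herm p z m)) \<odot> dagger M =
      herm (p + m - form z u) (z - form z u *\<^sub>R u + m *\<^sub>R u) m"
    and "M \<odot> (mat_conjg (herm p z m) \<odot> dagger M) =
      herm (p + m - form z u) (z - form z u *\<^sub>R u + m *\<^sub>R u) m"
  unfolding reflection_unit[OF assms(1)] M_def
  by (simp_all add: herm_def mat22_ops na_simps mult_conjg_eq flexible assms(1) form_eq
      na_diff_left na_diff_right conjg_diff scaleR_left_diff_distrib scaleR_left_distrib
      algebra_simps)

theorem simple_reflection_eq_matrix_product:
  fixes a :: "nat \<Rightarrow> 'k::alternative_algebra"
  assumes "simple_roots_of_finite_type a" "\<theta> * conjg \<theta> = 1"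
    and I: "I \<in> {-1..int (dim (UNIV :: 'k set))}" and "X \<in> H2"
  shows "simple_reflection a \<theta> I X = (refl_mat a \<theta> I \<odot> mat_conjg X) \<odot> dagger (refl_mat a \<theta> I) \<and>
    simple_reflection a \<theta> I X = refl_mat a \<theta> I \<odot> (mat_conjg X \<odot> dagger (refl_mat a \<theta> I))"
proof -
  obtain p z m where X: "X = herm p z m"
    using \<open>X \<in> H2\<close> unfolding H2_eq by blast
  have \<theta>: "qnorm \<theta> = 1"
    using assms(2) by (simp add: qnorm_def re_one)
  consider "I = -1" | "I = 0" | "I > 0"
    using I by force
  then show ?thesis
  proof cases
    case 1
    then show ?thesis
      unfolding X 1 simple_reflection_herm
      by (simp add: refl_mat_def herm_def mat22_ops na_simps)
  next
    case 2
    then show ?thesis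
      by (simp add: X simple_reflection_herm \<theta> refl_mat_def triangular_product_herm)
  next
    case 3
    then have "nat I \<in> {1..dim (UNIV :: 'k set)}"
      using I by auto
    then have "a (nat I) \<noteq> 0"
      by (rule simple_root_nonzero[OF assms(1)])
    then show ?thesis
      using 3 by (simp add: X simple_reflection_herm refl_mat_def diagonal_product_herm
          qnorm_unit_root form_unit_root)
  qed
qed

theorem theorem1:
  shows
   "(\<forall>(a :: nat \<Rightarrow> real) \<theta>.
      simple_roots_of_finite_type a \<and> highest_root a \<theta> \<and> \<theta> * conjg \<theta> = 1 \<longrightarrow>
      (\<forall>I\<in>{-1..int (dim (UNIV :: real set))}. \<forall>X\<in>H2.
         simple_reflection a \<theta> I X = (refl_mat a \<theta> I \<odot> mat_conjg X) \<odot> dagger (refl_mat a \<theta> I) \<and>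
         simple_reflection a \<theta> I X = refl_mat a \<theta> I \<odot> (mat_conjg X \<odot> dagger (refl_mat a \<theta> I)))) \<and>
    (\<forall>(a :: nat \<Rightarrow> complex) \<theta>.
      simple_roots_of_finite_type a \<and> highest_root a \<theta> \<and> \<theta> * conjg \<theta> = 1 \<longrightarrow>
      (\<forall>I\<in>{-1..int (dim (UNIV :: complex set))}. \<forall>X\<in>H2.
         simple_reflection a \<theta> I X = (refl_mat a \<theta> I \<odot> mat_conjg X) \<odot> dagger (refl_mat a \<theta> I) \<and>
         simple_reflection a \<theta> I X = refl_mat a \<theta> I \<odot> (mat_conjg X \<odot> dagger (refl_mat a \<theta> I)))) \<and>
    (\<forall>(a :: nat \<Rightarrow> quaternion) \<theta>.
      simple_roots_of_finite_type a \<and> highest_root a \<theta> \<and> \<theta> * conjg \<theta> = 1 \<longrightarrow>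
      (\<forall>I\<in>{-1..int (dim (UNIV :: quaternion set))}. \<forall>X\<in>H2.
         simple_reflection a \<theta> I X = (refl_mat a \<theta> I \<odot> mat_conjg X) \<odot> dagger (refl_mat a \<theta> I) \<and>
         simple_reflection a \<theta> I X = refl_mat a \<theta> I \<odot> (mat_conjg X \<odot> dagger (refl_mat a \<theta> I)))) \<and>
    (\<forall>(a :: nat \<Rightarrow> octonion) \<theta>.
      simple_roots_of_finite_type a \<and> highest_root a \<theta> \<and> \<theta> * conjg \<theta> = 1 \<longrightarrow>
      (\<forall>I\<in>{-1..int (dim (UNIV :: octonion set))}. \<forall>X\<in>H2.
         simple_reflection a \<theta> I X = (refl_mat a \<theta> I \<odot> mat_conjg X) \<odot> dagger (refl_mat a \<theta> I) \<and>
         simple_reflection a \<theta> I X = refl_mat a \<theta> I \<odot> (mat_conjg X \<odot> dagger (refl_mat a \<theta> I))))"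
  by (intro conjI allI impI ballI; (elim conjE)?;
    blast dest: simple_reflection_eq_matrix_product)

end
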